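(* Let $d\geq 2$, let $\xi\in\mathbb{C}$ with $\xi^2=-1$, let $p_{i,d-i}\in\mathbb{C}$ for $0\le i\le d$, let $P(x,y)=\sum_{i=0}^{d}p_{i,d-i}x^iy^{d-i}$ be a homogeneous polynomial of degree $d$, and let $$X=\xi(x\partial_x-y\partial_y)+P(x,y)\partial_x+\Big(\sum_{i=0}^{d}\overline{p_{d-i,i}}\,x^iy^{d-i}\Big)\partial_y .$$ If the coefficients of $P$ satisfy $$p_{d-i+1,i-1}-\overline{p_{i,d-i}}=0\quad (i=1,\dots,d)\qquad\text{and}\qquad p_{0,d}=0,$$ then the Lie algebra $\mathfrak{b}$ generated by the family $\mathbf{B}(X)=\{B_n\}_{n\in A(X)}$ of homogeneous differential operators of $X$ is nilpotent of order $1$.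
   Context: $X$ is the complex representation on $\mathbb{C}^2$ of a real planar polynomial vector field (with $y=\bar x$ on the real plane); for algebraic computations $x,y$ are treated as independent variables, and $\partial_x=\partial/\partial x$, $\partial_y=\partial/\partial y$. The vector field is decomposed as $X=\xi(x\partial_x-y\partial_y)+\sum_{n\in A(X)}B_n$, where $B_n$ is a homogeneous differential operator of degree $n=(n_1,n_2)\in\mathbb{Z}^2$, i.e. it maps each monomial $x^{m_1}y^{m_2}$ to a constant multiple of $x^{m_1+n_1}y^{m_2+n_2}$, and $A(X)$ is the set of degrees which occur. Here the operators are $$B_{(i-1,d-i)}=x^{i-1}y^{d-i}\big(p_{i,d-i}\,x\partial_x+\overline{p_{d-i+1,i-1}}\,y\partial_y\big)\ (1\le i\le d),\quad B_{(-1,d)}=p_{0,d}\,y^d\partial_x,\quad B_{(d,-1)}=\overline{p_{0,d}}\,x^d\partial_y .$$ $[\cdot,\cdot]$ is the usual Lie bracket (commutator) of vector fields. "Nilpotent of order $1$" means that $[\mathfrak{b},\mathfrak{b}]=0$, i.e. $[B_n,B_m]=0$ for all $n,m\in A(X)$. *)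

theory Defs
  imports Complex_Main "HOL-Computational_Algebra.Polynomial"
begin

(* C[x,y] is represented as (C[x])[y]: the outer polynomial variable is y, the inner one is x. *)
type_synonym cpoly2 = "complex poly poly"

definition mono2 :: "complex \<Rightarrow> nat \<Rightarrow> nat \<Rightarrow> cpoly2" where
  "mono2 c i j = monom (monom c i) j"

definition scal :: "complex \<Rightarrow> cpoly2 \<Rightarrow> cpoly2" where
  "scal c f = smult [:c:] f"

definition varx :: cpoly2 where "varx = mono2 1 1 0"
definition vary :: cpoly2 where "vary = mono2 1 0 1"

definition dx :: "cpoly2 \<Rightarrow> cpoly2" where "dx f = map_poly pderiv f"
definition dy :: "cpoly2 \<Rightarrow> cpoly2" where "dy f = pderiv f"

(* A polynomial vector field is identified with the derivation of C[x,y] it induces. *)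
type_synonym diffop = "cpoly2 \<Rightarrow> cpoly2"

definition vfield :: "cpoly2 \<Rightarrow> cpoly2 \<Rightarrow> diffop" where
  "vfield P Q = (\<lambda>f. P * dx f + Q * dy f)"

definition poly_vfields :: "diffop set" where
  "poly_vfields = {vfield P Q | P Q. True}"

definition lin_part :: "complex \<Rightarrow> diffop" where
  "lin_part \<xi> = (\<lambda>f. scal \<xi> (varx * dx f - vary * dy f))"

definition lie_bracket :: "diffop \<Rightarrow> diffop \<Rightarrow> diffop" where
  "lie_bracket U V = (\<lambda>f. U (V f) - V (U f))"

(* Exponents live in the integers; a target monomial with a negative exponent is not a
   polynomial, so the operator must then annihilate the source monomial. *)
definition homogeneous_op :: "int \<times> int \<Rightarrow> diffop \<Rightarrow> bool" where
  "homogeneous_op n D \<longleftrightarrow>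
     (\<forall>m1 m2 :: nat.
        if int m1 + fst n \<ge> 0 \<and> int m2 + snd n \<ge> 0
        then \<exists>c. D (mono2 1 m1 m2) = mono2 c (nat (int m1 + fst n)) (nat (int m2 + snd n))
        else D (mono2 1 m1 m2) = 0)"

definition hom_decomposition ::
  "complex \<Rightarrow> diffop \<Rightarrow> (int \<times> int) set \<Rightarrow> (int \<times> int \<Rightarrow> diffop) \<Rightarrow> bool" where
  "hom_decomposition \<xi> X A B \<longleftrightarrow>
     finite A \<and>
     (\<forall>n\<in>A. B n \<in> poly_vfields \<and> homogeneous_op n (B n) \<and> B n \<noteq> (\<lambda>f. 0)) \<and>
     X = (\<lambda>f. lin_part \<xi> f + (\<Sum>n\<in>A. B n f))"

definition op_subspace :: "diffop set \<Rightarrow> bool" where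
  "op_subspace L \<longleftrightarrow>
     (\<lambda>f. 0) \<in> L \<and>
     (\<forall>U\<in>L. \<forall>V\<in>L. (\<lambda>f. U f + V f) \<in> L) \<and>
     (\<forall>c. \<forall>U\<in>L. (\<lambda>f. scal c (U f)) \<in> L)"

definition lie_subalgebra :: "diffop set \<Rightarrow> bool" where
  "lie_subalgebra L \<longleftrightarrow>
     L \<subseteq> poly_vfields \<and> op_subspace L \<and> (\<forall>U\<in>L. \<forall>V\<in>L. lie_bracket U V \<in> L)"

definition lie_generated :: "diffop set \<Rightarrow> diffop set" where
  "lie_generated S = lie_subalgebra hull S"

definition lie_product :: "diffop set \<Rightarrow> diffop set \<Rightarrow> diffop set" where
  "lie_product L M = op_subspace hull {lie_bracket U V | U V. U \<in> L \<and> V \<in> M}"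

definition nilpotent_of_order_1 :: "diffop set \<Rightarrow> bool" where
  "nilpotent_of_order_1 L \<longleftrightarrow> lie_product L L = {\<lambda>f. 0}"

(* The explicit components of the field with coefficients p; they form the unique
   homogeneous decomposition, see explicit_decomposition and hom_decomposition_unique. *)
definition compB :: "nat \<Rightarrow> (nat \<Rightarrow> nat \<Rightarrow> complex) \<Rightarrow> int \<times> int \<Rightarrow> diffop" where
  "compB d p n =
     (if n = (-1, int d) then (\<lambda>f. scal (p 0 d) (vary ^ d * dx f))
      else if n = (int d, -1) then (\<lambda>f. scal (cnj (p 0 d)) (varx ^ d * dy f))
      else if fst n \<ge> 0 \<and> snd n \<ge> 0 \<and> fst n + snd n = int d - 1 then
        (let i = nat (fst n) + 1 in
         (\<lambda>f. varx ^ (i - 1) * vary ^ (d - i) *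
              (scal (p i (d - i)) (varx * dx f) +
               scal (cnj (p (d - i + 1) (i - 1))) (vary * dy f))))
      else (\<lambda>f. 0))"

lemma scal_mono2: "scal c f = mono2 c 0 0 * f"
  by (simp add: scal_def mono2_def monom_0)

lemma mono2_mult: "mono2 a i j * mono2 b k l = mono2 (a * b) (i + k) (j + l)"
  by (simp add: mono2_def mult_monom)

lemma mono2_0 [simp]: "mono2 0 i j = 0"
  by (simp add: mono2_def)

lemma dx_mono2: "dx (mono2 c i j) = mono2 (of_nat i * c) (i - 1) j"
  by (simp add: dx_def mono2_def map_poly_monom pderiv_monom)

lemma dy_mono2: "dy (mono2 c i j) = mono2 (of_nat j * c) i (j - 1)"
proof -
  have "of_nat j * monom c i = monom (of_nat j * c) i"
    by (simp add: of_nat_monom mult_monom)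
  then show ?thesis
    by (simp add: dy_def mono2_def pderiv_monom)
qed

lemma varx_power: "varx ^ k = mono2 1 k 0"
  by (induction k) (simp_all add: varx_def mono2_mult, simp add: mono2_def)

lemma vary_power: "vary ^ k = mono2 1 0 k"
  by (induction k) (simp_all add: vary_def mono2_mult, simp add: mono2_def)

lemma scal_monomial: "scal c (varx ^ i * vary ^ j) = mono2 c i j"
  by (simp add: varx_power vary_power scal_mono2 mono2_mult)

lemma dx_add: "dx (f + g) = dx f + dx g"
  by (simp add: dx_def poly_eq_iff coeff_map_poly pderiv_add)

lemma dy_add: "dy (f + g) = dy f + dy g"
  by (simp add: dy_def pderiv_add)

lemma dx_scal: "dx (scal c f) = scal c (dx f)"
  by (simp add: dx_def scal_def poly_eq_iff coeff_map_poly pderiv_smult)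

lemma dy_scal: "dy (scal c f) = scal c (dy f)"
  by (simp add: dy_def scal_def pderiv_smult)

lemma vfield_add: "vfield P Q (f + g) = vfield P Q f + vfield P Q g"
  by (simp add: vfield_def dx_add dy_add algebra_simps)

lemma vfield_scal: "vfield P Q (scal c f) = scal c (vfield P Q f)"
  by (simp add: vfield_def dx_scal dy_scal) (simp add: scal_mono2 algebra_simps)

lemma poly_vfields_linear:
  assumes "D \<in> poly_vfields"
  shows "D (f + g) = D f + D g" "D (scal c f) = scal c (D f)"
  using assms by (auto simp: poly_vfields_def vfield_add vfield_scal)

lemma cpoly2_induct:
  assumes "\<And>c i j. Q (scal c (mono2 1 i j))" "\<And>f g. Q f \<Longrightarrow> Q g \<Longrightarrow> Q (f + g)"
  shows "Q (f :: cpoly2)"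
proof -
  have Q0: "Q 0"
    using assms(1)[of 0 0 0] by (simp add: scal_def)
  have Qs: "Q (sum h S)" if "finite S" "\<And>i. i \<in> S \<Longrightarrow> Q (h i)" for h :: "nat \<Rightarrow> cpoly2" and S
    using that by (induction S) (auto simp: Q0 assms(2))
  have m: "Q (monom q j)" for q j
  proof -
    have "monom q j = monom (\<Sum>i\<le>degree q. monom (coeff q i) i) j"
      by (simp add: poly_as_sum_of_monoms)
    also have "\<dots> = (\<Sum>i\<le>degree q. monom (monom (coeff q i) i) j)"
      by (intro poly_eqI) (simp add: coeff_sum)
    also have "\<dots> = (\<Sum>i\<le>degree q. scal (coeff q i) (mono2 1 i j))"
      by (simp add: scal_mono2 mono2_mult) (simp add: mono2_def)
    finally show ?thesis
      by (simp add: Qs assms(1))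
  qed
  have "Q (\<Sum>j\<le>degree f. monom (coeff f j) j)"
    by (rule Qs) (simp_all add: m)
  then show ?thesis
    by (simp add: poly_as_sum_of_monoms)
qed

lemma poly_vfields_eqI:
  assumes "U \<in> poly_vfields" "V \<in> poly_vfields" "\<And>i j. U (mono2 1 i j) = V (mono2 1 i j)"
  shows "U = V"
proof
  fix f show "U f = V f"
    by (induction f rule: cpoly2_induct)
      (simp_all add: assms(3) poly_vfields_linear[OF assms(1)] poly_vfields_linear[OF assms(2)])
qed

lemma zero_poly_vfield: "(\<lambda>f. 0) \<in> poly_vfields"
  unfolding poly_vfields_def vfield_def by (auto intro!: exI[of _ 0])

definition icoeff :: "cpoly2 \<Rightarrow> int \<Rightarrow> int \<Rightarrow> complex" where
  "icoeff f a b = (if a \<ge> 0 \<and> b \<ge> 0 then coeff (coeff f (nat b)) (nat a) else 0)"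

lemma icoeff_sum: "icoeff (sum h S) a b = (\<Sum>s\<in>S. icoeff (h s) a b)"
  by (cases "a \<ge> 0 \<and> b \<ge> 0") (auto simp: icoeff_def coeff_sum)

lemma icoeff_homogeneous_ne:
  assumes "homogeneous_op n D" "k \<noteq> n"
  shows "icoeff (D (mono2 1 i j)) (int i + fst k) (int j + snd k) = 0"
proof (cases "int i + fst n \<ge> 0 \<and> int j + snd n \<ge> 0")
  case True
  then obtain c where c: "D (mono2 1 i j) = mono2 c (nat (int i + fst n)) (nat (int j + snd n))"
    using assms(1) unfolding homogeneous_op_def by metis
  have "fst k \<noteq> fst n \<or> snd k \<noteq> snd n"
    using assms(2) by (auto simp: prod_eq_iff)
  then show ?thesis
    unfolding c using True by (auto simp: icoeff_def mono2_def)
next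
  case False
  then have "D (mono2 1 i j) = 0"
    using assms(1) unfolding homogeneous_op_def by metis
  then show ?thesis by (simp add: icoeff_def)
qed

lemma homogeneous_eqI:
  assumes "homogeneous_op n U" "homogeneous_op n V"
    "icoeff (U (mono2 1 i j)) (int i + fst n) (int j + snd n) =
     icoeff (V (mono2 1 i j)) (int i + fst n) (int j + snd n)"
  shows "U (mono2 1 i j) = V (mono2 1 i j)"
proof (cases "int i + fst n \<ge> 0 \<and> int j + snd n \<ge> 0")
  case True
  obtain c where c: "U (mono2 1 i j) = mono2 c (nat (int i + fst n)) (nat (int j + snd n))"
    using assms(1) True unfolding homogeneous_op_def by metis
  obtain e where e: "V (mono2 1 i j) = mono2 e (nat (int i + fst n)) (nat (int j + snd n))"
    using assms(2) True unfolding homogeneous_op_def by metis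
  show ?thesis
    using assms(3) True unfolding c e by (simp add: icoeff_def mono2_def)
next
  case False
  then show ?thesis
    using assms(1,2) unfolding homogeneous_op_def by metis
qed

lemma zero_homogeneous: "homogeneous_op n (\<lambda>f. 0)"
  unfolding homogeneous_op_def by (auto intro!: exI[of _ 0])

lemma hom_decomposition_unique:
  assumes "hom_decomposition \<xi> X A B" "hom_decomposition \<xi> X A' B'"
  shows "A = A'" "\<And>n. n \<in> A \<Longrightarrow> B n = B' n"
proof -
  define E where "E = (\<lambda>n. if n \<in> A then B n else (\<lambda>f. 0))"
  define E' where "E' = (\<lambda>n. if n \<in> A' then B' n else (\<lambda>f. 0))"
  have fin: "finite A" "finite A'"
    using assms by (simp_all add: hom_decomposition_def)
  have v: "E n \<in> poly_vfields" "E' n \<in> poly_vfields"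
    and h: "homogeneous_op n (E n)" "homogeneous_op n (E' n)" for n
    using assms by (auto simp: hom_decomposition_def E_def E'_def zero_poly_vfield zero_homogeneous)
  have sE: "(\<Sum>n\<in>A. B n f) = (\<Sum>n\<in>A \<union> A'. E n f)" for f
    by (rule sum.mono_neutral_cong_left) (use fin in \<open>auto simp: E_def\<close>)
  have sE': "(\<Sum>n\<in>A'. B' n f) = (\<Sum>n\<in>A \<union> A'. E' n f)" for f
    by (rule sum.mono_neutral_cong_left) (use fin in \<open>auto simp: E'_def\<close>)
  have "X = (\<lambda>f. lin_part \<xi> f + (\<Sum>n\<in>A. B n f))"
    using assms(1) unfolding hom_decomposition_def by blast
  moreover have "X = (\<lambda>f. lin_part \<xi> f + (\<Sum>n\<in>A'. B' n f))"
    using assms(2) unfolding hom_decomposition_def by blast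
  ultimately have "lin_part \<xi> f + (\<Sum>n\<in>A. B n f) = lin_part \<xi> f + (\<Sum>n\<in>A'. B' n f)" for f
    by meson
  then have eq: "(\<Sum>n\<in>A \<union> A'. E n f) = (\<Sum>n\<in>A \<union> A'. E' n f)" for f
    by (simp add: sE sE')
  have "E n = E' n" for n
  proof (cases "n \<in> A \<union> A'")
    case True
    have pick: "icoeff (\<Sum>k\<in>A \<union> A'. F k (mono2 1 i j)) (int i + fst n) (int j + snd n) =
       icoeff (F n (mono2 1 i j)) (int i + fst n) (int j + snd n)"
      if "\<And>k. homogeneous_op k (F k)" for F i j
    proof -
      have "icoeff (\<Sum>k\<in>A \<union> A'. F k (mono2 1 i j)) (int i + fst n) (int j + snd n) =
        (\<Sum>k\<in>A \<union> A'. if k = n then icoeff (F n (mono2 1 i j)) (int i + fst n) (int j + snd n) else 0)"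
        unfolding icoeff_sum by (intro sum.cong refl) (simp add: icoeff_homogeneous_ne[OF that])
      then show ?thesis
        using True fin by simp
    qed
    show ?thesis
    proof (rule poly_vfields_eqI[OF v])
      fix i j
      show "E n (mono2 1 i j) = E' n (mono2 1 i j)"
        using homogeneous_eqI[OF h, of n i j] pick[OF h(1), of i j] pick[OF h(2), of i j]
          eq[of "mono2 1 i j"] by simp
    qed
  next
    case False
    then show ?thesis by (simp add: E_def E'_def)
  qed
  moreover have "n \<in> A \<longleftrightarrow> E n \<noteq> (\<lambda>f. 0)" "n \<in> A' \<longleftrightarrow> E' n \<noteq> (\<lambda>f. 0)" for n
    using assms by (auto simp: hom_decomposition_def E_def E'_def)
  ultimately show AA: "A = A'" by auto
  show "B n = B' n" if "n \<in> A" for n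
    using \<open>E n = E' n\<close> that AA by (simp add: E_def E'_def)
qed

lemma compB_vfield:
  assumes "i \<le> d + 1" "d \<ge> 1"
  shows "compB d p (int i - 1, int d - int i) =
    vfield (if i \<le> d then mono2 (p i (d - i)) i (d - i) else 0)
           (if 1 \<le> i then mono2 (cnj (p (d + 1 - i) (i - 1))) (i - 1) (d + 1 - i) else 0)"
proof -
  consider "i = 0" | "i = d + 1" | "1 \<le> i" "i \<le> d"
    using assms by linarith
  then show ?thesis
  proof cases
    case 1
    then show ?thesis
      by (simp add: compB_def vfield_def vary_power scal_mono2 mono2_mult mult.assoc[symmetric])
  next
    case 2
    then show ?thesis
      using assms
      by (simp add: compB_def vfield_def varx_power scal_mono2 mono2_mult mult.assoc[symmetric])
  next
    case 3
    then have "nat (int i - 1) + 1 = i" "int d - int i \<noteq> int d" "int i - 1 \<noteq> int d" by auto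
    with 3 have "compB d p (int i - 1, int d - int i) =
        (\<lambda>f. mono2 1 (i - 1) 0 * mono2 1 0 (d - i) *
              (mono2 (p i (d - i)) 0 0 * (mono2 1 1 0 * dx f) +
               mono2 (cnj (p (d - i + 1) (i - 1))) 0 0 * (mono2 1 0 1 * dy f)))"
      unfolding compB_def Let_def varx_power vary_power scal_mono2
      by (simp add: varx_def vary_def)
    also have "\<dots> = (\<lambda>f. mono2 (p i (d - i)) i (d - i) * dx f +
        mono2 (cnj (p (d - i + 1) (i - 1))) (i - 1) (d - i + 1) * dy f)"
      using 3 by (simp add: distrib_left mult.assoc[symmetric] mono2_mult)
    finally show ?thesis
      using 3 by (simp add: vfield_def Suc_diff_le)
  qed
qed

lemma compB_zero:
  assumes "d \<ge> 1" "n \<notin> (\<lambda>i. (int i - 1, int d - int i)) ` {0..d+1}"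
  shows "compB d p n = (\<lambda>f. 0)"
proof -
  have ne: "n \<noteq> (int i - 1, int d - int i)" if "i \<le> d + 1" for i
    using assms(2) that by auto
  from ne[of 0] ne[of "d + 1"] have "n \<noteq> (-1, int d)" "n \<noteq> (int d, -1)"
    by auto
  moreover have "\<not> (fst n \<ge> 0 \<and> snd n \<ge> 0 \<and> fst n + snd n = int d - 1)"
  proof
    assume *: "fst n \<ge> 0 \<and> snd n \<ge> 0 \<and> fst n + snd n = int d - 1"
    then have "nat (fst n) + 1 \<le> d + 1" by linarith
    from ne[OF this] * show False by (auto simp: prod_eq_iff)
  qed
  ultimately show ?thesis
    unfolding compB_def by (simp only: if_False)
qed

lemma compB_in_vfields:
  assumes "d \<ge> 1" shows "compB d p n \<in> poly_vfields"
proof (cases "n \<in> (\<lambda>i. (int i - 1, int d - int i)) ` {0..d+1}")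
  case True
  then obtain i where "i \<le> d + 1" "n = (int i - 1, int d - int i)" by auto
  then show ?thesis
    using compB_vfield[of i d p] assms unfolding poly_vfields_def by blast
next
  case False
  show ?thesis
    unfolding compB_zero[OF assms False] by (rule zero_poly_vfield)
qed

lemma vfield_mono2_homogeneous:
  assumes "a = 0 \<or> (int i = fst n + 1 \<and> int j = snd n)"
    and "b = 0 \<or> (int k = fst n \<and> int l = snd n + 1)"
  shows "homogeneous_op n (vfield (mono2 a i j) (mono2 b k l))"
  unfolding homogeneous_op_def
proof (intro allI)
  fix m1 m2 :: nat
  let ?D = "vfield (mono2 a i j) (mono2 b k l) (mono2 1 m1 m2)"
  let ?e = "nat (int m1 + fst n)" and ?f = "nat (int m2 + snd n)"
  have D: "?D = mono2 (a * of_nat m1) (i + (m1 - 1)) (j + m2) +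
                mono2 (b * of_nat m2) (k + m1) (l + (m2 - 1))"
    by (simp add: vfield_def dx_mono2 dy_mono2 mono2_mult)
  show "if int m1 + fst n \<ge> 0 \<and> int m2 + snd n \<ge> 0
        then \<exists>c. ?D = mono2 c ?e ?f else ?D = 0"
  proof (cases "int m1 + fst n \<ge> 0 \<and> int m2 + snd n \<ge> 0")
    case True
    have 1: "mono2 (a * of_nat m1) (i + (m1 - 1)) (j + m2) = mono2 (a * of_nat m1) ?e ?f"
    proof (cases "a = 0 \<or> m1 = 0")
      case False
      then have "i + (m1 - 1) = ?e" "j + m2 = ?f" using assms(1) True by auto
      then show ?thesis by simp
    qed auto
    have 2: "mono2 (b * of_nat m2) (k + m1) (l + (m2 - 1)) = mono2 (b * of_nat m2) ?e ?f"
    proof (cases "b = 0 \<or> m2 = 0")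
      case False
      then have "k + m1 = ?e" "l + (m2 - 1) = ?f" using assms(2) True by auto
      then show ?thesis by simp
    qed auto
    have "?D = mono2 (a * of_nat m1 + b * of_nat m2) ?e ?f"
      unfolding D 1 2 by (simp add: mono2_def add_monom)
    then show ?thesis using True by auto
  next
    case False
    have "a = 0 \<or> m1 = 0" using assms(1) False by (cases "m1 = 0") auto
    moreover have "b = 0 \<or> m2 = 0" using assms(2) False by (cases "m2 = 0") auto
    ultimately have "?D = 0" unfolding D by auto
    then show ?thesis using False by auto
  qed
qed

lemma compB_homogeneous:
  assumes "d \<ge> 1" shows "homogeneous_op n (compB d p n)"
proof (cases "n \<in> (\<lambda>i. (int i - 1, int d - int i)) ` {0..d+1}")
  case True
  then obtain i where i: "i \<le> d + 1" "n = (int i - 1, int d - int i)" by auto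
  have eq: "compB d p n =
    vfield (mono2 (if i \<le> d then p i (d - i) else 0) i (d - i))
           (mono2 (if 1 \<le> i then cnj (p (d + 1 - i) (i - 1)) else 0) (i - 1) (d + 1 - i))"
    unfolding i(2) compB_vfield[OF i(1) assms] by (cases "i \<le> d"; cases "1 \<le> i"; simp)
  show ?thesis
    unfolding eq by (rule vfield_mono2_homogeneous) (use i in auto)
next
  case False
  show ?thesis
    unfolding compB_zero[OF assms False] by (rule zero_homogeneous)
qed

lemma vfield_sum:
  "finite S \<Longrightarrow> vfield (sum g S) (sum h S) f = (\<Sum>s\<in>S. vfield (g s) (h s) f)"
  by (simp add: vfield_def sum.distrib sum_distrib_right)

lemma explicit_decomposition:
  fixes d :: nat
  assumes d: "d \<ge> 2"
  shows "hom_decomposition \<xi>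
    (\<lambda>f. scal \<xi> (varx * dx f - vary * dy f)
         + (\<Sum>i=0..d. scal (p i (d - i)) (varx ^ i * vary ^ (d - i))) * dx f
         + (\<Sum>i=0..d. scal (cnj (p (d - i) i)) (varx ^ i * vary ^ (d - i))) * dy f)
    {n. compB d p n \<noteq> (\<lambda>f. 0)} (compB d p)"
proof -
  let ?I = "(\<lambda>i. (int i - 1, int d - int i)) ` {0..d+1}"
  let ?g = "\<lambda>i. if i \<le> d then mono2 (p i (d - i)) i (d - i) else 0"
  let ?h = "\<lambda>i. if 1 \<le> i then mono2 (cnj (p (d + 1 - i) (i - 1))) (i - 1) (d + 1 - i) else 0"
  let ?A = "{n. compB d p n \<noteq> (\<lambda>f. 0)}"
  have d1: "d \<ge> 1" using d by simp
  have sub: "?A \<subseteq> ?I" using compB_zero[OF d1] by blast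
  have g: "(\<Sum>i=0..d. mono2 (p i (d - i)) i (d - i)) = sum ?g {0..d+1}"
    by simp
  have h: "(\<Sum>i=0..d. mono2 (cnj (p (d - i) i)) i (d - i)) = sum ?h {0..d+1}"
  proof -
    have "sum ?h {0..d+1} = sum ?h {0..0} + sum ?h {Suc 0..Suc d}"
      by (simp add: sum.atLeast_Suc_atMost)
    also have "\<dots> = (\<Sum>i=0..d. ?h (Suc i))"
      unfolding sum.shift_bounds_cl_Suc_ivl by simp
    also have "\<dots> = (\<Sum>i=0..d. mono2 (cnj (p (d - i) i)) i (d - i))"
      by simp
    finally show ?thesis by simp
  qed
  have "vfield (sum ?g {0..d+1}) (sum ?h {0..d+1}) f = (\<Sum>n\<in>?A. compB d p n f)" for f
  proof -
    have "(\<Sum>n\<in>?A. compB d p n f) = (\<Sum>n\<in>?I. compB d p n f)"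
      by (rule sum.mono_neutral_left) (use sub in auto)
    also have "\<dots> = (\<Sum>i\<in>{0..d+1}. compB d p (int i - 1, int d - int i) f)"
      by (subst sum.reindex) (auto simp: inj_on_def)
    also have "\<dots> = (\<Sum>i\<in>{0..d+1}. vfield (?g i) (?h i) f)"
      by (intro sum.cong) (use compB_vfield d1 in auto)
    finally show ?thesis by (simp only: vfield_sum finite_atLeastAtMost)
  qed
  then have "(\<lambda>f. scal \<xi> (varx * dx f - vary * dy f)
         + (\<Sum>i=0..d. scal (p i (d - i)) (varx ^ i * vary ^ (d - i))) * dx f
         + (\<Sum>i=0..d. scal (cnj (p (d - i) i)) (varx ^ i * vary ^ (d - i))) * dy f)
      = (\<lambda>f. lin_part \<xi> f + (\<Sum>n\<in>?A. compB d p n f))"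
    unfolding vfield_def lin_part_def scal_monomial g h by (simp only: add.assoc)
  then show ?thesis
    unfolding hom_decomposition_def
    using finite_subset[OF sub] compB_in_vfields[OF d1] compB_homogeneous[OF d1] by auto
qed

end

theory Submission
  imports Defs
begin

text \<open>
  The condition on the coefficients makes both components of each \<open>B\<^sub>n\<close> share one
  coefficient, so that \<open>B\<^sub>n\<close> is a monomial of degree \<open>d - 1\<close> times the Euler
  field \<open>E = x \<partial>\<^sub>x + y \<partial>\<^sub>y\<close>, while \<open>p\<^sub>0\<^sub>d = 0\<close> removes the two components
  \<open>y\<^sup>d \<partial>\<^sub>x\<close> and \<open>x\<^sup>d \<partial>\<^sub>y\<close> that are not multiples of \<open>E\<close> (lemma \<open>compB_radial\<close>).

  Multiples of \<open>E\<close> satisfy \<open>[h E, k E] = (h E(k) - k E(h)) E\<close> (lemma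
  \<open>lie_bracket_radial\<close>). By Euler's identity, \<open>E\<close> multiplies a homogeneous polynomial
  of degree \<open>d - 1\<close> by \<open>d - 1\<close>, so \<open>[h E, k E] = 0\<close> whenever \<open>h\<close> and \<open>k\<close> are both
  homogeneous of that degree. The fields \<open>h E\<close> with \<open>h\<close> homogeneous of degree \<open>d - 1\<close>
  thus form an abelian Lie algebra (lemma \<open>lie_subalgebra_radial_fields\<close>). It contains
  every \<open>B\<^sub>n\<close>, hence also the Lie algebra that they generate, whose derived algebra
  must then vanish.
\<close>

definition euler :: diffop where
  "euler f = varx * dx f + vary * dy f"

definition radial :: "cpoly2 \<Rightarrow> diffop" where
  "radial h = (\<lambda>f. h * euler f)"

text \<open>
  Homogeneity is encoded by Euler's identity: over a field of characteristic zero the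
  eigenspace of \<open>E\<close> for the eigenvalue \<open>m\<close> consists of the homogeneous polynomials of
  degree \<open>m\<close>. As an eigenspace it is visibly closed under addition and scaling.
\<close>
definition radial_fields :: "nat \<Rightarrow> diffop set" where
  "radial_fields m = {radial h | h. euler h = of_nat m * h}"

lemma dx_mult: "dx (f * g) = f * dx g + g * dx f"
proof -
  have sum: "pderiv (sum h S) = (\<Sum>s\<in>S. pderiv (h s))" if "finite S"
    for h :: "nat \<Rightarrow> complex poly" and S
    using that by (induction S) (simp_all add: pderiv_add)
  have "coeff (dx (f * g)) n = coeff (f * dx g + dx f * g) n" for n
    by (simp add: dx_def coeff_map_poly coeff_mult sum pderiv_mult sum.distrib
        mult.commute[of "coeff g _"])
  then show ?thesis
    by (simp add: poly_eq_iff mult.commute)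
qed

lemma euler_mult: "euler (f * g) = f * euler g + g * euler f"
  by (simp add: euler_def dx_mult dy_def pderiv_mult algebra_simps)

lemma euler_add: "euler (f + g) = euler f + euler g"
  by (simp add: euler_def dx_add dy_add algebra_simps)

lemma euler_scal: "euler (scal c f) = scal c (euler f)"
  by (simp add: euler_def dx_scal dy_scal) (simp add: scal_mono2 algebra_simps)

lemma euler_mono2: "euler (mono2 c i j) = of_nat (i + j) * mono2 c i j"
proof -
  have of_nat: "of_nat n = mono2 (of_nat n) 0 0" for n
    by (simp add: mono2_def of_nat_poly monom_0)
  have "varx * dx (mono2 c i j) = mono2 (of_nat i * c) i j"
    by (cases i) (simp_all add: varx_def dx_mono2 mono2_mult)
  moreover have "vary * dy (mono2 c i j) = mono2 (of_nat j * c) i j"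
    by (cases j) (simp_all add: vary_def dy_mono2 mono2_mult)
  ultimately show ?thesis
    unfolding euler_def of_nat mono2_mult by (simp add: mono2_def add_monom distrib_right)
qed

lemma radial_eq_vfield: "radial h = vfield (h * varx) (h * vary)"
  by (simp add: radial_def vfield_def euler_def algebra_simps fun_eq_iff)

text \<open>
  The two terms \<open>h k E(E f)\<close> and \<open>k h E(E f)\<close> cancel, so the bracket is again a multiple
  of \<open>E\<close>.
\<close>
lemma lie_bracket_radial:
  "lie_bracket (radial h) (radial k) = radial (h * euler k - k * euler h)"
  by (simp add: lie_bracket_def radial_def euler_mult algebra_simps fun_eq_iff)

lemma lie_bracket_radial_fields:
  assumes "U \<in> radial_fields m" "V \<in> radial_fields m"
  shows "lie_bracket U V = (\<lambda>f. 0)"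
  using assms
  by (auto simp: radial_fields_def lie_bracket_radial) (simp add: radial_def algebra_simps)

lemma zero_in_radial_fields: "(\<lambda>f. 0) \<in> radial_fields m"
  unfolding radial_fields_def
  by (auto simp: radial_def euler_def dx_def dy_def intro!: exI[of _ 0])

lemma op_subspace_radial_fields: "op_subspace (radial_fields m)"
  unfolding op_subspace_def
proof (intro conjI ballI allI)
  show "(\<lambda>f. 0) \<in> radial_fields m"
    by (rule zero_in_radial_fields)
next
  fix U V assume "U \<in> radial_fields m" "V \<in> radial_fields m"
  then obtain h k where "U = radial h" "V = radial k"
    and e: "euler h = of_nat m * h" "euler k = of_nat m * k"
    unfolding radial_fields_def by blast
  then have "(\<lambda>f. U f + V f) = radial (h + k)"
    by (simp add: radial_def algebra_simps)
  moreover have "euler (h + k) = of_nat m * (h + k)"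
    by (simp add: euler_add e algebra_simps)
  ultimately show "(\<lambda>f. U f + V f) \<in> radial_fields m"
    unfolding radial_fields_def by blast
next
  fix c U assume "U \<in> radial_fields m"
  then obtain h where "U = radial h" and e: "euler h = of_nat m * h"
    unfolding radial_fields_def by blast
  then have "(\<lambda>f. scal c (U f)) = radial (scal c h)"
    by (simp add: radial_def scal_mono2 algebra_simps)
  moreover have "euler (scal c h) = of_nat m * scal c h"
    unfolding euler_scal e by (simp add: scal_mono2 algebra_simps)
  ultimately show "(\<lambda>f. scal c (U f)) \<in> radial_fields m"
    unfolding radial_fields_def by blast
qed

lemma lie_subalgebra_radial_fields: "lie_subalgebra (radial_fields m)"
  unfolding lie_subalgebra_def
proof (intro conjI ballI)
  show "radial_fields m \<subseteq> poly_vfields"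
    by (auto simp: radial_fields_def poly_vfields_def radial_eq_vfield)
qed (simp_all add: op_subspace_radial_fields lie_bracket_radial_fields zero_in_radial_fields)

lemma nilpotent_of_order_1I:
  assumes "\<And>U V. U \<in> L \<Longrightarrow> V \<in> L \<Longrightarrow> lie_bracket U V = (\<lambda>f. 0)"
  shows "nilpotent_of_order_1 L"
proof -
  have "op_subspace {\<lambda>f. 0}"
    by (auto simp: op_subspace_def scal_def)
  then have "lie_product L L \<subseteq> {\<lambda>f. 0}"
    unfolding lie_product_def by (intro hull_minimal) (use assms in auto)
  (* Also for an empty L the spanned subspace contains the zero operator. *)
  moreover have "(\<lambda>f. 0) \<in> lie_product L L"
    unfolding lie_product_def hull_def by (auto simp: op_subspace_def)
  ultimately show ?thesis
    unfolding nilpotent_of_order_1_def by blast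
qed

text \<open>
  An abelian Lie algebra containing a family of fields contains everything the family
  generates, so it suffices to control the generators.
\<close>
lemma nilpotent_lie_generated_radial:
  assumes "S \<subseteq> radial_fields m"
  shows "nilpotent_of_order_1 (lie_generated S)"
proof -
  have "lie_generated S \<subseteq> radial_fields m"
    unfolding lie_generated_def using assms lie_subalgebra_radial_fields
    by (rule hull_minimal)
  then show ?thesis
    by (intro nilpotent_of_order_1I lie_bracket_radial_fields) auto
qed

text \<open>
  The symmetry of the coefficients is what allows \<open>p\<^sub>i x\<^sup>i\<^sup>-\<^sup>1 y\<^sup>d\<^sup>-\<^sup>i\<close> to be factored out of
  both components, leaving \<open>E\<close>.
\<close>
lemma compB_radial:
  assumes d: "d \<ge> 1"
    and sym: "\<And>i. i \<in> {1..d} \<Longrightarrow> p (d - i + 1) (i - 1) = cnj (p i (d - i))"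
    and p0: "p 0 d = 0"
  shows "compB d p n \<in> radial_fields (d - 1)"
proof (cases "n \<in> (\<lambda>i. (int i - 1, int d - int i)) ` {0..d+1}")
  case True
  then obtain i where i: "i \<le> d + 1" and n: "n = (int i - 1, int d - int i)"
    by auto
  show ?thesis
  proof (cases "i \<in> {1..d}")
    case True
    define h where "h = mono2 (p i (d - i)) (i - 1) (d - i)"
    have "compB d p n = vfield (mono2 (p i (d - i)) i (d - i))
        (mono2 (p i (d - i)) (i - 1) (d + 1 - i))"
      using True sym[OF True] by (simp add: n compB_vfield[OF i d] Suc_diff_le)
    also have "\<dots> = radial h"
      using True by (simp add: radial_eq_vfield h_def varx_def vary_def mono2_mult Suc_diff_le)
    finally show ?thesis
      using True by (auto simp: radial_fields_def h_def euler_mono2)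
  next
    case False
    (* The degrees (-1, d) and (d, -1), whose coefficient is p 0 d or its conjugate. *)
    then have "i = 0 \<or> i = d + 1"
      using i by auto
    then have "compB d p n = vfield 0 0"
      using compB_vfield[OF i d, of p] p0 by (auto simp: n)
    also have "\<dots> = (\<lambda>f. 0)"
      by (simp add: vfield_def)
    finally show ?thesis
      by (simp add: zero_in_radial_fields)
  qed
next
  case False
  show ?thesis
    unfolding compB_zero[OF d False] by (rule zero_in_radial_fields)
qed

theorem lemma4:
  fixes d :: nat and \<xi> :: complex and p :: "nat \<Rightarrow> nat \<Rightarrow> complex"
    and P Q :: cpoly2 and X :: diffop
    and A :: "(int \<times> int) set" and B :: "int \<times> int \<Rightarrow> diffop"
  assumes "d \<ge> 2"
    and "\<xi>\<^sup>2 = -1"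
    and "P = (\<Sum>i=0..d. scal (p i (d - i)) (varx ^ i * vary ^ (d - i)))"
    and "Q = (\<Sum>i=0..d. scal (cnj (p (d - i) i)) (varx ^ i * vary ^ (d - i)))"
    and "X = (\<lambda>f. scal \<xi> (varx * dx f - vary * dy f) + P * dx f + Q * dy f)"
    and "hom_decomposition \<xi> X A B"
    and "\<forall>i\<in>{1..d}. p (d - i + 1) (i - 1) - cnj (p i (d - i)) = 0"
    and "p 0 d = 0"
  shows "nilpotent_of_order_1 (lie_generated (B ` A))"
proof (rule nilpotent_lie_generated_radial)
  (* The homogeneous decomposition is unique, so the given components are the explicit ones. *)
  have "hom_decomposition \<xi> X {n. compB d p n \<noteq> (\<lambda>f. 0)} (compB d p)"
    unfolding assms(3-5) by (rule explicit_decomposition[OF assms(1)])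
  then have "B n = compB d p n" if "n \<in> A" for n
    using hom_decomposition_unique(2)[OF assms(6)] that by blast
  moreover have "compB d p n \<in> radial_fields (d - 1)" for n
    by (rule compB_radial) (use assms(1,7,8) in auto)
  ultimately show "B ` A \<subseteq> radial_fields (d - 1)"
    by auto
qed

end
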